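(* Let $G$ be a connected graph with at least two vertices and maximum degree at least $3$, and let $g\in \mathrm{Aut}(Y(G))$. Then there are a unique $\sigma\in\mathrm{Aut}(G)$ and a unique $f\in\mathrm{Aut}(X(G))$ such that for all $uv\in E(G)$, $g(a(u,v))=f(a(\sigma(u),\sigma(v)))$ and $g(b(u,v))=f(b(\sigma(u),\sigma(v)))$. Moreover, $\mathrm{Aut}(Y(G))=\{f\circ\tau_\sigma : f\in\mathrm{Aut}(X(G)),\ \sigma\in\mathrm{Aut}(G)\}$.
   Context: All graphs are finite, simple and undirected. For a connected graph $G$ with at least two vertices: for each vertex $u$ of $G$ let $A(u)=\{a(u,v): uv\in E(G)\}$ and $B(u)=\{b(u,v): uv\in E(G)\}$ be sets of new pairwise distinct elements, and let $M(u)$ be the set of all subsets of $A(u)$ of even cardinality, each regarded as a new vertex (middle vertices). The gadget $Y(u)$ has vertex set $A(u)\cup B(u)\cup M(u)$ and, for $m\in M(u)$, the edge $\{a(u,v),m\}$ if $a(u,v)\in m$ and the edge $\{b(u,v),m\}$ if $a(u,v)\notin m$. The graph $Y(G)$ is the disjoint union of all gadgets $Y(u)$ together with, for each edge $uv\in E(G)$, the edges $\{a(u,v),a(v,u)\}$ and $\{b(u,v),b(v,u)\}$. The colored graph $X(G)$ is $Y(G)$ with a vertex coloring in which two vertices $x,y$ have the same color iff they lie in the same gadget $Y(u)$ and either $x=y$, or both are middle vertices, or $\{x,y\}=\{a(u,v),b(u,v)\}$ for some $v$; $\mathrm{Aut}(X(G))$ is the set of color-preserving automorphisms, viewed as a subset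 of $\mathrm{Aut}(Y(G))$. For $\sigma\in\mathrm{Aut}(G)$, $\tau_\sigma$ denotes the automorphism of $Y(G)$ given by $\tau_\sigma(a(u,v))=a(\sigma(u),\sigma(v))$, $\tau_\sigma(b(u,v))=b(\sigma(u),\sigma(v))$ for $uv\in E(G)$, and $\tau_\sigma(m)=\{a(\sigma(u),\sigma(w)) : a(u,w)\in m\}$ for $m\in M(u)$. *)

theory Defs
  imports Main "HOL-Combinatorics.Permutations"
begin

record 'a ugraph =
  verts :: "'a set"
  edges :: "'a set set"

definition simple_graph :: "'a ugraph \<Rightarrow> bool" where
  "simple_graph G \<longleftrightarrow> finite (verts G) \<and>
     (\<forall>e\<in>edges G. \<exists>u\<in>verts G. \<exists>v\<in>verts G. u \<noteq> v \<and> e = {u, v})"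

definition connected_graph :: "'a ugraph \<Rightarrow> bool" where
  "connected_graph G \<longleftrightarrow> verts G \<noteq> {} \<and>
     (\<forall>u\<in>verts G. \<forall>v\<in>verts G. (u, v) \<in> {(x, y). {x, y} \<in> edges G}\<^sup>*)"

definition degree :: "'a ugraph \<Rightarrow> 'a \<Rightarrow> nat" where
  "degree G u = card {v. {u, v} \<in> edges G}"

definition max_degree :: "'a ugraph \<Rightarrow> nat" where
  "max_degree G = Max (degree G ` verts G)"

text \<open>Automorphisms are total functions that are the identity outside the vertex set
  (this is part of \<^const>\<open>permutes\<close>), so that equality of
  functions is equality of automorphisms.\<close>

definition Aut :: "'a ugraph \<Rightarrow> ('a \<Rightarrow> 'a) set" where
  "Aut G = {f. f permutes verts G \<and>
     (\<forall>u\<in>verts G. \<forall>v\<in>verts G. {f u, f v} \<in> edges G \<longleftrightarrow> {u, v} \<in> edges G)}"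

text \<open>\<open>AV u v\<close> and \<open>BV u v\<close> are $a(u,v)$ and $b(u,v)$. In a middle vertex \<open>MV u m\<close> of the
  gadget at \<open>u\<close>, the subset of $A(u)$ is given by the set \<open>m\<close> of the pairs \<open>(u, v)\<close> with
  $a(u,v)$ in the subset; the tag \<open>u\<close> keeps the empty subsets of different gadgets apart.\<close>

datatype 'a yvert = AV 'a 'a | BV 'a 'a | MV 'a "('a \<times> 'a) set"

definition A_verts :: "'a ugraph \<Rightarrow> 'a \<Rightarrow> 'a yvert set" where
  "A_verts G u = {AV u v | v. {u, v} \<in> edges G}"

definition B_verts :: "'a ugraph \<Rightarrow> 'a \<Rightarrow> 'a yvert set" where
  "B_verts G u = {BV u v | v. {u, v} \<in> edges G}"

definition even_subsets :: "'a ugraph \<Rightarrow> 'a \<Rightarrow> ('a \<times> 'a) set set" where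
  "even_subsets G u = {m. m \<subseteq> {(u, v) | v. {u, v} \<in> edges G} \<and> even (card m)}"

definition M_verts :: "'a ugraph \<Rightarrow> 'a \<Rightarrow> 'a yvert set" where
  "M_verts G u = MV u ` even_subsets G u"

definition gadget :: "'a ugraph \<Rightarrow> 'a \<Rightarrow> 'a yvert ugraph" where
  "gadget G u = \<lparr>
     verts = A_verts G u \<union> B_verts G u \<union> M_verts G u,
     edges =
       {{AV u v, MV u m} | v m. {u, v} \<in> edges G \<and> m \<in> even_subsets G u \<and> (u, v) \<in> m} \<union>
       {{BV u v, MV u m} | v m. {u, v} \<in> edges G \<and> m \<in> even_subsets G u \<and> (u, v) \<notin> m}\<rparr>"

definition Y :: "'a ugraph \<Rightarrow> 'a yvert ugraph" where
  "Y G = \<lparr>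
     verts = (\<Union>u\<in>verts G. verts (gadget G u)),
     edges = (\<Union>u\<in>verts G. edges (gadget G u)) \<union>
       {{AV u v, AV v u} | u v. {u, v} \<in> edges G} \<union>
       {{BV u v, BV v u} | u v. {u, v} \<in> edges G}\<rparr>"

definition same_color :: "'a ugraph \<Rightarrow> 'a yvert \<Rightarrow> 'a yvert \<Rightarrow> bool" where
  "same_color G x y \<longleftrightarrow>
     (\<exists>u\<in>verts G. x \<in> verts (gadget G u) \<and> y \<in> verts (gadget G u) \<and>
       (x = y \<or>
        (x \<in> M_verts G u \<and> y \<in> M_verts G u) \<or>
        (\<exists>v. {u, v} \<in> edges G \<and> {x, y} = {AV u v, BV u v})))"

definition Aut_X :: "'a ugraph \<Rightarrow> ('a yvert \<Rightarrow> 'a yvert) set" where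
  "Aut_X G = {f \<in> Aut (Y G). \<forall>x\<in>verts (Y G). same_color G (f x) x}"

definition tau :: "'a ugraph \<Rightarrow> ('a \<Rightarrow> 'a) \<Rightarrow> 'a yvert \<Rightarrow> 'a yvert" where
  "tau G \<sigma> x =
     (if x \<in> verts (Y G) then
        (case x of
           AV u v \<Rightarrow> AV (\<sigma> u) (\<sigma> v)
         | BV u v \<Rightarrow> BV (\<sigma> u) (\<sigma> v)
         | MV u m \<Rightarrow> MV (\<sigma> u) {(\<sigma> u, \<sigma> w) | w. (u, w) \<in> m})
      else x)"

end

theory Submission imports Defs begin

text \<open>
  A middle vertex of a gadget of degree at least three has any two of its neighbours on a
  common 6-cycle through it, whereas no 6-cycle of \<open>Y(G)\<close> uses an edge between two gadgets.
  Hence every automorphism \<open>g\<close> of \<open>Y(G)\<close> maps some gadget onto a gadget, pairs \<open>a(u,v), b(u,v)\<close>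
  going to such pairs, because only these have no common neighbour. This property
  spreads along the edges of \<open>G\<close>: once the pair of \<open>(v,u)\<close> and its outer neighbours are under
  control, \<open>M(v)\<close> consists of the remaining neighbours of that pair, and every other
  \<open>a(v,w)\<close>, \<open>b(v,w)\<close> has a neighbour in \<open>M(v)\<close>. By connectedness \<open>g\<close> permutes all gadgets, which
  yields \<open>\<sigma>\<close>, and \<open>g\<close> composed with the inverse of \<open>\<tau>\<^sub>\<sigma>\<close> preserves colours.
\<close>

section \<open>Signed notation for \<open>a\<close> and \<open>b\<close>; automorphisms of finite
  graphs\<close>

text \<open>Treating \<open>a\<close> and \<open>b\<close> as two signs turns the gadget's two edge
  rules into one equation: \<open>cv s u v\<close> is joined to \<open>MV u m\<close> iff
  \<open>((u, v) \<in> m) = s\<close>.\<close>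

definition cv :: "bool \<Rightarrow> 'a \<Rightarrow> 'a \<Rightarrow> 'a yvert" where
  "cv s u v = (if s then AV u v else BV u v)"

lemma cv_eq_iff [simp]: "cv s u v = cv t u' v' \<longleftrightarrow> s = t \<and> u = u' \<and> v = v'"
  by (auto simp: cv_def)

lemma cv_neq_MV [simp]: "cv s u v \<noteq> MV w m" "MV w m \<noteq> cv s u v"
  by (auto simp: cv_def)

lemma AV_eq_cv: "AV u v = cv True u v" and BV_eq_cv: "BV u v = cv False u v"
  by (auto simp: cv_def)

lemma yvert_cv_cases:
  obtains s u v where "x = cv s u v" | u m where "x = MV u m"
  by (cases x) (auto simp: AV_eq_cv BV_eq_cv)

text \<open>The injective map that \<open>f\<close> induces on the finite edge set is surjective, so
  preserving edges in one direction suffices.\<close>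

lemma Aut_from_edges:
  assumes "f permutes verts H" "finite (edges H)"
    and V: "\<And>e. e \<in> edges H \<Longrightarrow> e \<subseteq> verts H"
    and E: "\<And>e. e \<in> edges H \<Longrightarrow> f ` e \<in> edges H"
  shows "f \<in> Aut H"
proof -
  have inj: "inj f" using assms(1) by (rule permutes_inj)
  have "inj_on ((`) f) (edges H)"
    using inj by (auto simp: inj_on_def inj_image_eq_iff)
  moreover have sub: "(`) f ` edges H \<subseteq> edges H" using E by auto
  ultimately have eq: "(`) f ` edges H = edges H"
    using assms(2) by (simp add: endo_inj_surj)
  have "f ` e \<in> edges H \<longleftrightarrow> e \<in> edges H" for e
  proof
    assume "f ` e \<in> edges H"
    then obtain e' where "e' \<in> edges H" "f ` e = f ` e'" using eq by (metis imageE)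
    then show "e \<in> edges H" using inj by (simp add: inj_image_eq_iff)
  qed (rule E)
  from this[of "{u, v}" for u v] show ?thesis using assms(1) by (simp add: Aut_def)
qed

lemma Aut_comp:
  assumes "f \<in> Aut H" "g \<in> Aut H" shows "f \<circ> g \<in> Aut H"
  using assms by (auto simp: Aut_def permutes_compose permutes_in_image)

lemma Aut_inv:
  assumes "f \<in> Aut H" shows "inv f \<in> Aut H"
proof -
  have f: "f permutes verts H" using assms by (simp add: Aut_def)
  have "{inv f u, inv f v} \<in> edges H \<longleftrightarrow> {u, v} \<in> edges H" if "u \<in> verts H" "v \<in> verts H" for u v
  proof -
    have "inv f u \<in> verts H" "inv f v \<in> verts H"
      using that permutes_inv[OF f] by (auto simp: permutes_in_image)
    then have "{f (inv f u), f (inv f v)} \<in> edges H \<longleftrightarrow> {inv f u, inv f v} \<in> edges H"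
      using assms by (simp add: Aut_def)
    then show ?thesis using permutes_inverses(1)[OF f] by simp
  qed
  then show ?thesis using permutes_inv[OF f] by (simp add: Aut_def)
qed

section \<open>Adjacency and finiteness of \<open>Y G\<close>\<close>

locale sgraph =
  fixes G :: "'a ugraph"
  assumes simple: "simple_graph G"
begin

abbreviation E :: "'a \<Rightarrow> 'a \<Rightarrow> bool" where
  "E u v \<equiv> {u, v} \<in> edges G"

abbreviation adj :: "'a yvert \<Rightarrow> 'a yvert \<Rightarrow> bool" where
  "adj x y \<equiv> {x, y} \<in> edges (Y G)"

lemma E_verts: "E u v \<Longrightarrow> u \<in> verts G \<and> v \<in> verts G \<and> u \<noteq> v"
  using simple unfolding simple_graph_def by (metis doubleton_eq_iff)

lemma finite_verts: "finite (verts G)"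
  using simple by (simp add: simple_graph_def)

lemma edges_Pow: "edges G \<subseteq> Pow (verts G)"
  using simple by (auto simp: simple_graph_def)

lemma finite_edges: "finite (edges G)"
  using edges_Pow finite_verts by (meson finite_Pow_iff finite_subset)

lemma adj_sym: "adj x y \<longleftrightarrow> adj y x"
  by (simp add: insert_commute)

lemma adj_cv_cv [simp]:
  "adj (cv s u v) (cv t u' v') \<longleftrightarrow> s = t \<and> u' = v \<and> v' = u \<and> E u v"
  by (auto simp: Y_def gadget_def cv_def doubleton_eq_iff insert_commute)

lemma adj_cv_MV [simp]:
  "adj (cv s u v) (MV u' m) \<longleftrightarrow> u' = u \<and> E u v \<and> m \<in> even_subsets G u \<and> ((u, v) \<in> m) = s"
  using E_verts[of u v] by (auto simp: Y_def gadget_def cv_def doubleton_eq_iff insert_commute)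

lemma adj_MV_cv [simp]:
  "adj (MV u' m) (cv s u v) \<longleftrightarrow> u' = u \<and> E u v \<and> m \<in> even_subsets G u \<and> ((u, v) \<in> m) = s"
  using adj_cv_MV adj_sym by blast

lemma adj_MV_MV [simp]: "\<not> adj (MV u m) (MV u' m')"
  by (auto simp: Y_def gadget_def doubleton_eq_iff)

lemma cv_in_Y [simp]: "cv s u v \<in> verts (Y G) \<longleftrightarrow> E u v"
  using E_verts[of u v]
  by (auto simp: Y_def gadget_def cv_def A_verts_def B_verts_def M_verts_def)

lemma MV_in_Y [simp]: "MV u m \<in> verts (Y G) \<longleftrightarrow> u \<in> verts G \<and> m \<in> even_subsets G u"
  by (auto simp: Y_def gadget_def A_verts_def B_verts_def M_verts_def)

lemma edge_of_Y:
  assumes "e \<in> edges (Y G)" obtains x y where "e = {x, y}"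
  using assms by (auto simp: Y_def gadget_def)

lemma adj_in_Y: "adj x y \<Longrightarrow> x \<in> verts (Y G)"
  by (cases x rule: yvert_cv_cases; cases y rule: yvert_cv_cases) (auto dest: E_verts)

lemma edges_Y_subset: "e \<in> edges (Y G) \<Longrightarrow> e \<subseteq> verts (Y G)"
  by (metis adj_in_Y adj_sym edge_of_Y empty_subsetI insert_subset)

lemma finite_Y: "finite (verts (Y G))"
proof -
  have "verts (Y G) \<subseteq> (\<lambda>(s, u, v). cv s u v) ` (UNIV \<times> verts G \<times> verts G)
      \<union> (\<lambda>(u, m). MV u m) ` (verts G \<times> Pow (verts G \<times> verts G))"
  proof
    fix x assume x: "x \<in> verts (Y G)"
    show "x \<in> (\<lambda>(s, u, v). cv s u v) ` (UNIV \<times> verts G \<times> verts G)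
      \<union> (\<lambda>(u, m). MV u m) ` (verts G \<times> Pow (verts G \<times> verts G))"
    proof (cases x rule: yvert_cv_cases)
      case (1 s u v)
      then show ?thesis using x E_verts[of u v] by (force simp: image_iff)
    next
      case (2 u m)
      then have "u \<in> verts G" "m \<subseteq> verts G \<times> verts G"
        using x E_verts by (auto simp: even_subsets_def)
      then show ?thesis using 2 by (auto simp: image_iff)
    qed
  qed
  then show ?thesis by (rule finite_subset) (use finite_verts in auto)
qed

lemma finite_edges_Y: "finite (edges (Y G))"
proof (rule finite_subset)
  show "edges (Y G) \<subseteq> Pow (verts (Y G))" using edges_Y_subset by blast
qed (use finite_Y in simp)

subsection \<open>Middle vertices\<close>

lemma empty_even [simp]: "{} \<in> even_subsets G u"
  by (simp add: even_subsets_def)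

lemma even_subsets_E: "m \<in> even_subsets G u \<Longrightarrow> (x, v) \<in> m \<Longrightarrow> x = u \<and> E u v"
  by (auto simp: even_subsets_def)

lemma even_subsets_eqI:
  assumes "m \<in> even_subsets G u" "m' \<in> even_subsets G u"
    and "\<And>w. E u w \<Longrightarrow> (u, w) \<in> m \<longleftrightarrow> (u, w) \<in> m'"
  shows "m = m'"
proof -
  have "(x, w) \<in> m \<longleftrightarrow> (x, w) \<in> m'" for x w
    using assms even_subsets_E[OF assms(1)] even_subsets_E[OF assms(2)] by blast
  then show ?thesis by auto
qed

lemma finite_even_subset:
  assumes "m \<in> even_subsets G u" shows "finite m"
proof (rule finite_subset)
  show "m \<subseteq> {u} \<times> verts G" using assms E_verts by (auto simp: even_subsets_def)
qed (use finite_verts in simp)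

text \<open>Toggling two distinct pairs preserves parity. This is the basic move from one middle
  vertex to another.\<close>

lemma even_subset_flip:
  assumes m: "m \<in> even_subsets G u" and ij: "E u i" "E u j" "i \<noteq> j"
  obtains m' where "m' \<in> even_subsets G u"
    "\<And>w. (u, w) \<in> m' \<longleftrightarrow> ((u, w) \<in> m) \<noteq> (w = i \<or> w = j)"
proof -
  \<comment> \<open>\<open>t x n\<close> toggles membership of \<open>x\<close> in \<open>n\<close>,
    which reverses the parity of \<open>card n\<close>.\<close>
  define t where "t x n = (if x \<in> n then n - {x} else insert x n)" for x and n :: "('a \<times> 'a) set"
  have t: "finite (t x n) \<and> (even (card (t x n)) \<longleftrightarrow> odd (card n))" if "finite n" for x n
  proof (cases "x \<in> n")
    case True
    then have eq: "t x n = n - {x}" by (simp add: t_def)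
    have "card n = Suc (card (t x n))" unfolding eq by (rule card.remove[OF that True])
    moreover have "finite (t x n)" unfolding eq using that by simp
    ultimately show ?thesis by simp
  qed (use that in \<open>simp add: t_def\<close>)
  let ?m = "t (u, i) (t (u, j) m)"
  have "even (card m)" using m by (simp add: even_subsets_def)
  then have "even (card ?m)"
    using t[OF finite_even_subset[OF m], of "(u, j)"] t[of "t (u, j) m" "(u, i)"] by blast
  moreover have tm: "y \<in> t x n \<longleftrightarrow> (y \<in> n) \<noteq> (y = x)" for x y n
    by (cases "x \<in> n") (auto simp: t_def)
  have "?m \<subseteq> insert (u, i) (insert (u, j) m)" by (auto simp: tm)
  then have "?m \<subseteq> {(u, v) |v. E u v}" using m ij by (auto simp: even_subsets_def)
  ultimately have "?m \<in> even_subsets G u" by (simp add: even_subsets_def)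
  moreover have "(u, w) \<in> ?m \<longleftrightarrow> ((u, w) \<in> m) \<noteq> (w = i \<or> w = j)" for w
    using ij(3) by (auto simp: tm)
  ultimately show ?thesis by (rule that)
qed

lemma even_subset_one:
  assumes "E u v" "E u w" "v \<noteq> w"
  obtains m where "m \<in> even_subsets G u" "((u, v) \<in> m) = s"
proof -
  obtain m where "m \<in> even_subsets G u" "(u, v) \<in> m"
    by (rule even_subset_flip[OF empty_even assms]) auto
  then show ?thesis using that[of m] that[of "{}"] by (cases s) auto
qed

text \<open>The third neighbour \<open>k\<close> absorbs the parity, so membership at
  \<open>i\<close> and at \<open>j\<close> can be chosen freely.\<close>

lemma even_subset_two:
  assumes "E u i" "E u j" "E u k" "i \<noteq> j" "i \<noteq> k" "j \<noteq> k"
  obtains m where "m \<in> even_subsets G u" "((u, i) \<in> m) = s" "((u, j) \<in> m) = t"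
proof -
  \<comment> \<open>\<open>m\<close> is \<open>{(u, i), (u, k)}\<close>; \<open>m1\<close> is
    \<open>m\<close> or \<open>{}\<close>, and toggling \<open>j\<close> and \<open>k\<close> in
    \<open>m1\<close> handles \<open>t = True\<close>.\<close>
  obtain m where m: "m \<in> even_subsets G u" "(u, i) \<in> m" "(u, j) \<notin> m"
    by (rule even_subset_flip[OF empty_even assms(1,3,5)]) (use assms in auto)
  obtain m1 where m1: "m1 \<in> even_subsets G u" "((u, i) \<in> m1) = s" "(u, j) \<notin> m1"
    using m empty_even[of u] by (cases s) blast+
  obtain m2 where m2: "m2 \<in> even_subsets G u"
    "\<And>w. (u, w) \<in> m2 \<longleftrightarrow> ((u, w) \<in> m1) \<noteq> (w = j \<or> w = k)"
    by (rule even_subset_flip[OF m1(1) assms(2,3,6)]) auto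
  show ?thesis
  proof (cases t)
    case True
    then show ?thesis using that[OF m2(1)] m1 m2(2)[of i] m2(2)[of j] assms by simp
  qed (use that m1 in auto)
qed

text \<open>A middle vertex sees exactly one sign over \<open>v\<close>, and the outer neighbours of
  the two signs are distinct.\<close>

lemma no_common_neighbour: "\<not> (adj x (cv s u v) \<and> adj x (cv (\<not> s) u v))"
  by (cases x rule: yvert_cv_cases) auto

subsection \<open>Hexagons\<close>

text \<open>A 6-cycle through the path \<open>y\<close>, \<open>x\<close>, \<open>z\<close>; the
  centre of the path is the first argument.\<close>

definition hexagon :: "'a yvert \<Rightarrow> 'a yvert \<Rightarrow> 'a yvert \<Rightarrow> bool" where
  "hexagon x y z \<longleftrightarrow> (\<exists>p q r. distinct [x, y, z, p, q, r] \<and>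
     adj y x \<and> adj x z \<and> adj z p \<and> adj p q \<and> adj q r \<and> adj r y)"

text \<open>An invariant under automorphisms, being expressed by adjacency alone. The three
  neighbours keep the second clause from holding vacuously and encode degree at least three.\<close>

definition hexagonal :: "'a yvert \<Rightarrow> bool" where
  "hexagonal x \<longleftrightarrow> (\<exists>y1 y2 y3. distinct [y1, y2, y3] \<and> adj x y1 \<and> adj x y2 \<and> adj x y3) \<and>
     (\<forall>y z. y \<noteq> z \<longrightarrow> adj x y \<longrightarrow> adj x z \<longrightarrow> hexagon x y z)"

definition big :: "'a \<Rightarrow> bool" where
  "big u \<longleftrightarrow> (\<exists>i j k. distinct [i, j, k] \<and> E u i \<and> E u j \<and> E u k)"

lemma big_third:
  assumes "big u" obtains k where "E u k" "k \<noteq> i" "k \<noteq> j"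
  using assms unfolding big_def by (metis distinct_length_2_or_more)

text \<open>A 6-cycle through the outer edge at \<open>cv s u v\<close> would have to cross between
  the gadgets of \<open>u\<close> and \<open>v\<close> a second time, and the only available
  crossing returns to \<open>cv s u v\<close>.\<close>

lemma not_hexagonal_cv: "\<not> hexagonal (cv s u v)"
proof
  assume h: "hexagonal (cv s u v)"
  then obtain z where z: "adj (cv s u v) z" "z \<noteq> cv s v u"
    unfolding hexagonal_def by (metis distinct_length_2_or_more)
  then obtain m where m: "z = MV u m" and uv: "E u v" "((u, v) \<in> m) = s"
    by (cases z rule: yvert_cv_cases) auto
  from uv have "adj (cv s u v) (cv s v u)" by simp
  with h z obtain p q r where d: "distinct [cv s u v, cv s v u, z, p, q, r]"
    and a: "adj z p" "adj p q" "adj q r" "adj r (cv s v u)"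
    unfolding hexagonal_def hexagon_def by metis
  from a(1) m obtain t w where p: "p = cv t u w" "((u, w) \<in> m) = t"
    by (cases p rule: yvert_cv_cases) auto
  from a(4) d obtain n where r: "r = MV v n"
    by (cases r rule: yvert_cv_cases) (auto simp: insert_commute)
  from a(3) r obtain t' w' where q: "q = cv t' v w'"
    by (cases q rule: yvert_cv_cases) auto
  \<comment> \<open>The edge from \<open>p\<close> to \<open>q\<close> joins the two gadgets, so
    \<open>p\<close> lies over \<open>v\<close>; as a neighbour of \<open>z\<close> it has sign
    \<open>s\<close>, hence it is the starting vertex.\<close>
  from a(2) p q have "w = v" by simp
  then show False using p uv d by auto
qed

lemma hexagonal_MV:
  assumes m: "m \<in> even_subsets G u" and u: "big u"
  shows "hexagonal (MV u m)"
  unfolding hexagonal_def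
proof (intro conjI allI impI)
  obtain i j k where ijk: "distinct [i, j, k]" "E u i" "E u j" "E u k"
    using u by (auto simp: big_def)
  then show "\<exists>y1 y2 y3. distinct [y1, y2, y3] \<and> adj (MV u m) y1 \<and> adj (MV u m) y2 \<and> adj (MV u m) y3"
    using m by (intro exI[of _ "cv ((u, i) \<in> m) u i"] exI[of _ "cv ((u, j) \<in> m) u j"]
        exI[of _ "cv ((u, k) \<in> m) u k"]) auto
next
  fix y z assume yz: "y \<noteq> z" "adj (MV u m) y" "adj (MV u m) z"
  obtain i where i: "y = cv ((u, i) \<in> m) u i" "E u i"
    using yz by (cases y rule: yvert_cv_cases) auto
  obtain j where j: "z = cv ((u, j) \<in> m) u j" "E u j"
    using yz by (cases z rule: yvert_cv_cases) auto
  have ij: "i \<noteq> j" using yz i j by auto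
  obtain k where k: "E u k" "k \<noteq> i" "k \<noteq> j" using big_third[OF u] .
  \<comment> \<open>\<open>m1\<close> agrees with \<open>m\<close> at \<open>i\<close>,
    \<open>m2\<close> agrees with \<open>m\<close> at \<open>j\<close>, and both differ from
    \<open>m\<close> at \<open>k\<close>. The 6-cycle is \<open>y\<close>, \<open>m\<close>,
    \<open>z\<close>, \<open>m2\<close>, the vertex over \<open>k\<close> with the sign opposite to
    that for \<open>m\<close>, \<open>m1\<close>.\<close>
  obtain m1 where m1: "m1 \<in> even_subsets G u"
      "\<And>w. (u, w) \<in> m1 \<longleftrightarrow> ((u, w) \<in> m) \<noteq> (w = j \<or> w = k)"
    using even_subset_flip[OF m j(2) k(1)] k by metis
  obtain m2 where m2: "m2 \<in> even_subsets G u"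
      "\<And>w. (u, w) \<in> m2 \<longleftrightarrow> ((u, w) \<in> m) \<noteq> (w = i \<or> w = k)"
    using even_subset_flip[OF m i(2) k(1)] k by metis
  have n: "(u, i) \<in> m1 \<longleftrightarrow> (u, i) \<in> m" "(u, k) \<in> m1 \<longleftrightarrow> (u, k) \<notin> m"
      "(u, j) \<in> m2 \<longleftrightarrow> (u, j) \<in> m" "(u, k) \<in> m2 \<longleftrightarrow> (u, k) \<notin> m"
    using m1(2)[of i] m1(2)[of k] m2(2)[of j] m2(2)[of k] ij k by simp_all
  have "m \<noteq> m1" "m \<noteq> m2" "m2 \<noteq> m1"
    using m1(2)[of j] m2(2)[of i] m2(2)[of j] ij k by blast+
  then show "hexagon (MV u m) y z"
    unfolding hexagon_def i(1) j(1)
    using i(2) j(2) k ij m m1(1) m2(1)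
    by (intro exI[of _ "MV u m2"] exI[of _ "cv ((u, k) \<notin> m) u k"] exI[of _ "MV u m1"])
      (simp add: n)
qed

text \<open>A middle vertex has one neighbour for each neighbour of \<open>u\<close> in
  \<open>G\<close>, so three distinct neighbours witness \<open>big u\<close>.\<close>

lemma hexagonal_iff:
  "hexagonal x \<longleftrightarrow> (\<exists>u m. x = MV u m \<and> m \<in> even_subsets G u \<and> big u)"
proof
  assume h: "hexagonal x"
  then obtain u m where x: "x = MV u m"
    using not_hexagonal_cv by (cases x rule: yvert_cv_cases) auto
  obtain y1 y2 y3 where y: "distinct [y1, y2, y3]" "adj x y1" "adj x y2" "adj x y3"
    using h unfolding hexagonal_def by blast
  have nb: "\<exists>i. y = cv ((u, i) \<in> m) u i \<and> E u i \<and> m \<in> even_subsets G u" if "adj x y" for y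
    using that x by (cases y rule: yvert_cv_cases) auto
  obtain i1 i2 i3 where "y1 = cv ((u, i1) \<in> m) u i1" "y2 = cv ((u, i2) \<in> m) u i2"
      "y3 = cv ((u, i3) \<in> m) u i3" "E u i1" "E u i2" "E u i3" "m \<in> even_subsets G u"
    using nb y by metis
  moreover from this y(1) have "distinct [i1, i2, i3]" by auto
  ultimately show "\<exists>u m. x = MV u m \<and> m \<in> even_subsets G u \<and> big u"
    using x unfolding big_def by blast
qed (use hexagonal_MV in blast)

end

subsection \<open>Automorphisms permute the gadgets\<close>

locale Y_aut = sgraph +
  fixes g :: "'a yvert \<Rightarrow> 'a yvert"
  assumes g: "g \<in> Aut (Y G)"
begin

lemma g_permutes: "g permutes verts (Y G)"
  using g by (simp add: Aut_def)

lemma g_inj [simp]: "g x = g y \<longleftrightarrow> x = y"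
  using permutes_inj[OF g_permutes] by (simp add: inj_eq)

lemma g_surj: obtains x where "y = g x"
  using permutes_surj[OF g_permutes] by (metis surjD)

lemma g_adj [simp]: "adj (g x) (g y) \<longleftrightarrow> adj x y"
proof (cases "x \<in> verts (Y G) \<and> y \<in> verts (Y G)")
  case True
  then show ?thesis using g by (simp add: Aut_def)
next
  case False
  then show ?thesis
    using permutes_in_image[OF g_permutes] adj_in_Y adj_sym by metis
qed

lemma hexagonal_image:
  assumes "hexagonal x" shows "hexagonal (g x)"
proof -
  have "hexagon (g x) (g y) (g z)" if "hexagon x y z" for x y z
  proof -
    from that obtain p q r where "distinct [x, y, z, p, q, r]"
      "adj y x" "adj x z" "adj z p" "adj p q" "adj q r" "adj r y"
      unfolding hexagon_def by blast
    then show ?thesis unfolding hexagon_def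
      by (intro exI[of _ "g p"] exI[of _ "g q"] exI[of _ "g r"]) auto
  qed
  then have "hexagon (g x) y z" if "y \<noteq> z" "adj (g x) y" "adj (g x) z" for y z
    using assms that unfolding hexagonal_def by (metis g_adj g_surj)
  moreover obtain y1 y2 y3 where "distinct [y1, y2, y3]" "adj x y1" "adj x y2" "adj x y3"
    using assms unfolding hexagonal_def by blast
  then have "\<exists>y1 y2 y3. distinct [y1, y2, y3] \<and> adj (g x) y1 \<and> adj (g x) y2 \<and> adj (g x) y3"
    by (intro exI[of _ "g y1"] exI[of _ "g y2"] exI[of _ "g y3"]) auto
  ultimately show ?thesis unfolding hexagonal_def by blast
qed

lemma hexagonal_iff_image: "hexagonal (g x) \<longleftrightarrow> hexagonal x"
proof
  interpret inv: Y_aut G "inv g" by unfold_locales (rule Aut_inv[OF g])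
  assume "hexagonal (g x)"
  from inv.hexagonal_image[OF this] show "hexagonal x"
    using permutes_inverses(2)[OF g_permutes] by simp
qed (rule hexagonal_image)

text \<open>The Boolean \<open>c\<close> below is false iff \<open>g\<close> exchanges the roles of \<open>a\<close> and \<open>b\<close> on the pair.\<close>

definition onto_gadget :: "'a \<Rightarrow> 'a \<Rightarrow> bool" where
  "onto_gadget v v' \<longleftrightarrow>
     (\<forall>m\<in>even_subsets G v. \<exists>m'\<in>even_subsets G v'. g (MV v m) = MV v' m') \<and>
     (\<forall>m'\<in>even_subsets G v'. \<exists>m\<in>even_subsets G v. g (MV v m) = MV v' m') \<and>
     (\<forall>w. E v w \<longrightarrow> (\<exists>w' c. E v' w' \<and> (\<forall>s. g (cv s v w) = cv (s = c) v' w')))"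

text \<open>If \<open>i\<close> and \<open>j\<close> differed, some even subset would be adjacent to
  both images, the parity being absorbed at \<open>k\<close>; but the two original vertices have no
  common neighbour.\<close>

lemma pair_to_pair:
  assumes T: "g (cv True v w) = cv t v' i" and F: "g (cv False v w) = cv t' v' j"
    and ij: "E v' i" "E v' j" and k: "E v' k" "k \<noteq> i" "k \<noteq> j"
  shows "i = j \<and> (\<exists>c. \<forall>s. g (cv s v w) = cv (s = c) v' i)"
proof
  show "i = j"
  proof (rule ccontr)
    assume ne: "i \<noteq> j"
    obtain m where "m \<in> even_subsets G v'" "((v', i) \<in> m) = t" "((v', j) \<in> m) = t'"
      using even_subset_two[OF ij k(1) ne k(2)[symmetric] k(3)[symmetric]] .
    then have *: "adj (MV v' m) (g (cv True v w))" "adj (MV v' m) (g (cv False v w))"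
      using T F ij by auto
    obtain x where "MV v' m = g x" by (rule g_surj)
    with * have "adj x (cv True v w)" "adj x (cv False v w)" by auto
    then show False using no_common_neighbour[of x True] by simp
  qed
  moreover from this T F have "t \<noteq> t'"
    using g_inj[of "cv True v w" "cv False v w"] by auto
  ultimately have "g (cv s v w) = cv (s = t) v' i" for s
    using T F by (cases s) auto
  then show "\<exists>c. \<forall>s. g (cv s v w) = cv (s = c) v' i" by blast
qed

text \<open>The neighbours of the pair over \<open>u\<close> are its outer neighbours and all of
  \<open>M(v)\<close>. Controlling both pairs therefore controls \<open>M(v)\<close>, and the other
  pairs of the gadget follow through their middle neighbours.\<close>

lemma onto_gadget_from_pair:
  assumes vu: "E v u" "E v' u'"
    and P: "\<And>s. g (cv s v u) = cv (s = c) v' u'"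
    and O: "\<And>s. g (cv s u v) = cv (s = c) u' v'"
  shows "onto_gadget v v'"
proof -
  have M: "\<exists>m'\<in>even_subsets G v'. g (MV v m) = MV v' m'" if m: "m \<in> even_subsets G v" for m
  proof -
    let ?s = "(v, u) \<in> m"
    have "adj (g (cv ?s v u)) (g (MV v m))" using m vu by simp
    then have a: "adj (cv (?s = c) v' u') (g (MV v m))" by (simp add: P)
    show ?thesis
    proof (cases "g (MV v m)" rule: yvert_cv_cases)
      \<comment> \<open>A non-middle image would be the outer neighbour over
        \<open>(u', v')\<close>, which is already the image of \<open>cv ?s u v\<close>.\<close>
      case (1 s x y)
      with a have "g (MV v m) = g (cv ?s u v)" by (simp add: O)
      then show ?thesis by simp
    qed (use a in auto)
  qed
  have M': "\<exists>m\<in>even_subsets G v. g (MV v m) = MV v' m'" if m: "m' \<in> even_subsets G v'" for m'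
  proof -
    obtain x where x: "MV v' m' = g x" by (rule g_surj)
    \<comment> \<open>The sign for which \<open>g (cv s v u)\<close> is the neighbour of
      \<open>MV v' m'\<close> over \<open>u'\<close>.\<close>
    obtain s where s: "(s = c) = ((v', u') \<in> m')" by blast
    have "adj (MV v' m') (g (cv s v u))" using m vu by (auto simp: P s)
    then have a: "adj x (cv s v u)" by (simp add: x)
    show ?thesis
    proof (cases x rule: yvert_cv_cases)
      case (1 t y z)
      with a have "x = cv s u v" by auto
      then have "g x = cv (s = c) u' v'" using O by simp
      then show ?thesis using x by (metis cv_neq_MV(2))
    qed (use a x in auto)
  qed
  have W: "\<exists>w' c. E v' w' \<and> (\<forall>s. g (cv s v w) = cv (s = c) v' w')" if w: "E v w" for w
  proof (cases "w = u")
    case True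
    then show ?thesis using vu P by blast
  next
    case False
    have C: "\<exists>t w'. E v' w' \<and> w' \<noteq> u' \<and> g (cv s v w) = cv t v' w'" for s
    proof -
      obtain m where m: "m \<in> even_subsets G v" "((v, w) \<in> m) = s"
        using even_subset_one[OF w vu(1) False] .
      obtain m' where m': "g (MV v m) = MV v' m'" using M[OF m(1)] by blast
      have "adj (g (cv s v w)) (g (MV v m))" using m w by simp
      then have "\<exists>t w'. E v' w' \<and> g (cv s v w) = cv t v' w'"
        unfolding m' by (cases "g (cv s v w)" rule: yvert_cv_cases) simp_all
      then obtain t w' where t: "E v' w'" "g (cv s v w) = cv t v' w'" by blast
      have "w' \<noteq> u'"
      proof
        assume "w' = u'"
        \<comment> \<open>Since \<open>((t = c) = c) = t\<close>, the vertex
          \<open>cv t v' u'\<close> is already taken by the pair over \<open>u\<close>.\<close>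
        with t have "g (cv s v w) = g (cv (t = c) v u)" by (cases t) (simp_all add: P)
        with False show False by simp
      qed
      with t show ?thesis by blast
    qed
    obtain t i where i: "E v' i" "u' \<noteq> i" "g (cv True v w) = cv t v' i"
      using C[of True] by auto
    obtain t' j where j: "E v' j" "u' \<noteq> j" "g (cv False v w) = cv t' v' j"
      using C[of False] by auto
    \<comment> \<open>The third neighbour of \<open>v'\<close> is \<open>u'\<close>, so the argument
      works at vertices of every degree.\<close>
    from pair_to_pair[OF i(3) j(3) i(1) j(1) vu(2) i(2) j(2)]
    obtain c' where "\<forall>s. g (cv s v w) = cv (s = c') v' i" by (elim conjE exE)
    with i(1) show ?thesis by (intro exI conjI)
  qed
  show ?thesis unfolding onto_gadget_def
    by (intro conjI ballI allI impI) (erule M M' W)+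
qed

text \<open>The propagation step along an edge of \<open>G\<close>: the outer neighbours of the pair
  over \<open>w\<close> go to outer neighbours, so \<open>onto_gadget_from_pair\<close> applies at
  \<open>w\<close>.\<close>

lemma onto_gadget_neighbour:
  assumes R: "onto_gadget v v'" and vw: "E v w"
  obtains w' c where "E v' w'" "onto_gadget w w'" "\<forall>s. g (cv s v w) = cv (s = c) v' w'"
proof -
  from R vw have "\<exists>w' c. E v' w' \<and> (\<forall>s. g (cv s v w) = cv (s = c) v' w')"
    by (simp add: onto_gadget_def)
  then obtain w' c where w': "E v' w'" and "\<forall>s. g (cv s v w) = cv (s = c) v' w'"
    by (elim exE conjE)
  then have P: "g (cv s v w) = cv (s = c) v' w'" for s by (rule_tac spec)
  have O: "g (cv s w v) = cv (s = c) w' v'" for s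
  proof -
    have "adj (g (cv s v w)) (g (cv s w v))" using vw by simp
    then have a: "adj (cv (s = c) v' w') (g (cv s w v))" by (simp add: P)
    show ?thesis
    proof (cases "g (cv s w v)" rule: yvert_cv_cases)
      case (2 x m)
      with a have "x = v'" "m \<in> even_subsets G v'" by auto
      \<comment> \<open>All middle vertices at \<open>v'\<close> are images of middle vertices at
        \<open>v\<close>, so by injectivity \<open>cv s w v\<close> cannot be sent to one.\<close>
      then have "\<exists>n. g (MV v n) = MV v' m"
        using R unfolding onto_gadget_def by fast
      then show ?thesis using 2 \<open>x = v'\<close> by (metis cv_neq_MV(1) g_inj)
    qed (use a in auto)
  qed
  from vw w' have "E w v" "E w' v'" by (simp_all add: insert_commute)
  then have "onto_gadget w w'" using O P by (rule onto_gadget_from_pair)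
  with w' show ?thesis using P by (intro that allI)
qed

text \<open>The starting point of the propagation. Middle vertices stay middle by hexagonality, and
  they stay together because those with a common neighbour must land in one gadget.\<close>

lemma onto_gadget_big:
  assumes u: "big u" obtains u' where "onto_gadget u u'"
proof -
  have M: "\<exists>x m'. g (MV u m) = MV x m' \<and> m' \<in> even_subsets G x \<and> big x"
    if "m \<in> even_subsets G u" for m
    using hexagonal_image[OF hexagonal_MV[OF that u]] by (simp add: hexagonal_iff)
  obtain u' m0 where u': "g (MV u {}) = MV u' m0" "big u'"
    using M[OF empty_even] by blast
  have share: "x = y"
    if "m \<in> even_subsets G u" "n \<in> even_subsets G u" "E u i" "((u, i) \<in> m) = ((u, i) \<in> n)"
      "g (MV u m) = MV x m'" "g (MV u n) = MV y n'" for m n i x y m' n'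
  proof -
    let ?c = "cv ((u, i) \<in> m) u i"
    have "adj (g ?c) (g (MV u m))" "adj (g ?c) (g (MV u n))" using that(1-4) by auto
    then show ?thesis unfolding that(5,6) by (cases "g ?c" rule: yvert_cv_cases) auto
  qed
  obtain i j k where ijk: "distinct [i, j, k]" "E u i" "E u j" "E u k"
    using u by (auto simp: big_def)
  have M': "\<exists>m'\<in>even_subsets G u'. g (MV u m) = MV u' m'" if m: "m \<in> even_subsets G u" for m
  proof -
    obtain x m' where x: "g (MV u m) = MV x m'" "m' \<in> even_subsets G x" using M[OF m] by blast
    have "x = u'"
    proof (cases "(u, i) \<in> m")
      case False
      then show ?thesis using share[OF m empty_even ijk(2) _ x(1) u'(1)] by simp
    next
      case True
      \<comment> \<open>\<open>n\<close> links \<open>m\<close> to \<open>{}\<close>: it agrees with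
        \<open>m\<close> at \<open>i\<close> and with \<open>{}\<close> at \<open>k\<close>.\<close>
      obtain n where n: "n \<in> even_subsets G u" "(u, i) \<in> n" "(u, k) \<notin> n"
        using even_subset_two[OF ijk(2,4,3), of True False] ijk(1) by auto
      obtain y n' where y: "g (MV u n) = MV y n'" using M[OF n(1)] by blast
      have "x = y" using share[OF m n(1) ijk(2) _ x(1) y] True n by simp
      moreover have "y = u'" using share[OF n(1) empty_even ijk(4) _ y u'(1)] n by simp
      ultimately show ?thesis by simp
    qed
    with x show ?thesis by blast
  qed
  have C: "\<exists>t w'. E u' w' \<and> g (cv s u i) = cv t u' w'" for s
  proof -
    obtain m where m: "m \<in> even_subsets G u" "((u, i) \<in> m) = s"
      using even_subset_one[OF ijk(2,3)] ijk(1) by auto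
    obtain m' where m': "g (MV u m) = MV u' m'" using M'[OF m(1)] by blast
    have "adj (g (cv s u i)) (g (MV u m))" using m ijk by simp
    then show ?thesis
      unfolding m' by (cases "g (cv s u i)" rule: yvert_cv_cases) simp_all
  qed
  obtain t p where p: "E u' p" "g (cv True u i) = cv t u' p" using C by blast
  obtain t' q where q: "E u' q" "g (cv False u i) = cv t' u' q" using C by blast
  obtain r where r: "E u' r" "r \<noteq> p" "r \<noteq> q" using big_third[OF u'(2)] .
  from pair_to_pair[OF p(2) q(2) p(1) q(1) r]
  obtain c where "\<forall>s. g (cv s u i) = cv (s = c) u' p" by (elim conjE exE)
  then have P: "g (cv s u i) = cv (s = c) u' p" for s by (rule spec)
  have O: "g (cv s i u) = cv (s = c) p u'" for s
  proof -
    have "adj (g (cv s u i)) (g (cv s i u))" using ijk by simp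
    then have a: "adj (cv (s = c) u' p) (g (cv s i u))" by (simp add: P)
    show ?thesis
    proof (cases "g (cv s i u)" rule: yvert_cv_cases)
      \<comment> \<open>A middle image would lie in the gadget of \<open>u'\<close>, which is big,
        and so would be hexagonal.\<close>
      case (2 x m)
      with a u' have "hexagonal (g (cv s i u))" by (auto intro: hexagonal_MV)
      then show ?thesis using hexagonal_iff_image not_hexagonal_cv by blast
    qed (use a in auto)
  qed
  from ijk(2) p(1) P O have "onto_gadget u u'" by (rule onto_gadget_from_pair)
  then show ?thesis by (rule that)
qed

lemma onto_gadget_unique:
  assumes "onto_gadget v v'" "onto_gadget v v''" shows "v' = v''"
  using assms empty_even[of v] unfolding onto_gadget_def by (metis yvert.inject(3))

text \<open>\<open>MV v' {}\<close> has a preimage in both gadgets.\<close>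

lemma onto_gadget_inj:
  assumes "onto_gadget v v'" "onto_gadget w v'" shows "v = w"
  using assms empty_even[of v'] unfolding onto_gadget_def by (metis g_inj yvert.inject(3))

text \<open>Induction along a walk from the big vertex \<open>u\<close>.\<close>

lemma onto_gadget_total:
  assumes "connected_graph G" "big u" "u \<in> verts G" "v \<in> verts G"
  shows "\<exists>v'. onto_gadget v v'"
proof -
  have "(u, v) \<in> {(x, y). {x, y} \<in> edges G}\<^sup>*"
    using assms by (simp add: connected_graph_def)
  then show ?thesis
  proof induction
    case base
    then show ?case using onto_gadget_big[OF assms(2)] by blast
  next
    case (step y z)
    then show ?case using onto_gadget_neighbour by (metis case_prodD mem_Collect_eq)
  qed
qed

lemma onto_gadget_Aut:
  assumes total: "\<And>v. v \<in> verts G \<Longrightarrow> \<exists>v'. onto_gadget v v'"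
    and isolated: "\<And>v. v \<in> verts G \<Longrightarrow> \<exists>w. E v w"
  obtains \<sigma> where "\<sigma> \<in> Aut G" "\<And>v. v \<in> verts G \<Longrightarrow> onto_gadget v (\<sigma> v)"
proof -
  \<comment> \<open>The identity off \<open>verts G\<close>, as \<open>permutes\<close>
    requires.\<close>
  define \<sigma> where "\<sigma> v = (if v \<in> verts G then SOME v'. onto_gadget v v' else v)" for v
  have \<sigma>: "onto_gadget v (\<sigma> v)" if "v \<in> verts G" for v
    using someI_ex[OF total[OF that]] that by (simp add: \<sigma>_def)
  have edge: "E (\<sigma> v) (\<sigma> w)" if vw: "E v w" for v w
  proof -
    have v: "v \<in> verts G" "w \<in> verts G" using E_verts[OF vw] by auto
    obtain w' c where w': "E (\<sigma> v) w'" "onto_gadget w w'"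
        "\<forall>s. g (cv s v w) = cv (s = c) (\<sigma> v) w'"
      using onto_gadget_neighbour[OF \<sigma>[OF v(1)] vw] .
    have "w' = \<sigma> w" using onto_gadget_unique[OF w'(2) \<sigma>[OF v(2)]] .
    with w'(1) show ?thesis by simp
  qed
  \<comment> \<open>Some edge at \<open>v\<close> is carried to an edge at
    \<open>\<sigma> v\<close>, whose endpoints are vertices.\<close>
  have "\<sigma> ` verts G \<subseteq> verts G" using isolated edge E_verts by blast
  moreover have inj: "inj_on \<sigma> (verts G)"
    using \<sigma> onto_gadget_inj by (metis inj_onI)
  ultimately have "bij_betw \<sigma> (verts G) (verts G)"
    by (simp add: bij_betw_def endo_inj_surj finite_verts)
  then have "\<sigma> permutes verts G" by (rule bij_imp_permutes) (simp add: \<sigma>_def)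
  moreover have "\<sigma> ` e \<in> edges G" if "e \<in> edges G" for e
    using that simple edge unfolding simple_graph_def by fastforce
  ultimately have "\<sigma> \<in> Aut G"
    using edges_Pow by (intro Aut_from_edges finite_edges) auto
  then show ?thesis using \<sigma> by (rule that)
qed

end

subsection \<open>Decomposition\<close>

context sgraph
begin

section \<open>Colour classes and the automorphisms \<open>tau\<close>\<close>

lemma cv_in_gadget: "cv s u v \<in> verts (gadget G x) \<longleftrightarrow> x = u \<and> E u v"
  by (auto simp: gadget_def cv_def A_verts_def B_verts_def M_verts_def)

lemma MV_in_gadget: "MV u m \<in> verts (gadget G x) \<longleftrightarrow> x = u \<and> m \<in> even_subsets G u"
  by (auto simp: gadget_def A_verts_def B_verts_def M_verts_def)

lemma same_color_cv:
  assumes "E u v" shows "same_color G x (cv s u v) \<longleftrightarrow> (\<exists>t. x = cv t u v)"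
proof
  assume "same_color G x (cv s u v)"
  then show "\<exists>t. x = cv t u v"
    by (auto simp: same_color_def cv_in_gadget M_verts_def AV_eq_cv BV_eq_cv doubleton_eq_iff)
next
  assume "\<exists>t. x = cv t u v"
  then obtain t where t: "x = cv t u v" ..
  have "u \<in> verts G" using E_verts[OF assms] by simp
  moreover have "x = cv s u v \<or> {x, cv s u v} = {AV u v, BV u v}"
    by (auto simp: t AV_eq_cv BV_eq_cv doubleton_eq_iff)
  ultimately show "same_color G x (cv s u v)"
    using assms t cv_in_gadget unfolding same_color_def by blast
qed

lemma same_color_MV:
  assumes "u \<in> verts G" "m \<in> even_subsets G u"
  shows "same_color G x (MV u m) \<longleftrightarrow> (\<exists>n\<in>even_subsets G u. x = MV u n)"
proof
  assume "same_color G x (MV u m)"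
  then show "\<exists>n\<in>even_subsets G u. x = MV u n"
    using assms by (auto simp: same_color_def MV_in_gadget M_verts_def doubleton_eq_iff)
next
  assume "\<exists>n\<in>even_subsets G u. x = MV u n"
  then show "same_color G x (MV u m)"
    using assms by (auto simp: same_color_def MV_in_gadget M_verts_def)
qed

lemma Aut_inj: "\<sigma> \<in> Aut H \<Longrightarrow> inj \<sigma>"
  using permutes_inj[of \<sigma> "verts H"] by (simp add: Aut_def)

lemma Aut_verts: "\<sigma> \<in> Aut H \<Longrightarrow> \<sigma> u \<in> verts H \<longleftrightarrow> u \<in> verts H"
  by (auto simp: Aut_def permutes_in_image)

lemma Aut_E:
  assumes \<sigma>: "\<sigma> \<in> Aut G" shows "E (\<sigma> u) (\<sigma> v) \<longleftrightarrow> E u v"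
proof (cases "u \<in> verts G \<and> v \<in> verts G")
  case True
  then show ?thesis using \<sigma> by (simp add: Aut_def)
next
  case False
  then show ?thesis using E_verts[of u v] E_verts[of "\<sigma> u" "\<sigma> v"] Aut_verts[OF \<sigma>] by blast
qed

lemma even_subsets_image:
  assumes \<sigma>: "\<sigma> \<in> Aut G" and m: "m \<in> even_subsets G u"
  shows "map_prod \<sigma> \<sigma> ` m \<in> even_subsets G (\<sigma> u)"
proof -
  have "card (map_prod \<sigma> \<sigma> ` m) = card m"
    by (intro card_image inj_on_subset[OF prod.inj_map[OF Aut_inj[OF \<sigma>] Aut_inj[OF \<sigma>]]]) simp
  moreover have "map_prod \<sigma> \<sigma> ` m \<subseteq> {(\<sigma> u, v) |v. E (\<sigma> u) v}"
  proof
    fix x assume "x \<in> map_prod \<sigma> \<sigma> ` m"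
    then obtain a b where ab: "x = (\<sigma> a, \<sigma> b)" "(a, b) \<in> m" by auto
    have "a = u" "E u b" using even_subsets_E[OF m ab(2)] by auto
    then show "x \<in> {(\<sigma> u, v) |v. E (\<sigma> u) v}" using ab(1) Aut_E[OF \<sigma>, of u b] by simp
  qed
  ultimately show ?thesis using m by (simp add: even_subsets_def)
qed

lemma tau_cv: "E u v \<Longrightarrow> tau G \<sigma> (cv s u v) = cv s (\<sigma> u) (\<sigma> v)"
  using cv_in_Y[of s u v] by (cases s) (simp_all add: tau_def cv_def)

text \<open>All first components in \<open>m\<close> equal \<open>u\<close>, so the set in
  \<open>tau\<close> is an image under \<open>map_prod\<close>, to which facts on injective images
  apply.\<close>

lemma tau_MV:
  assumes "u \<in> verts G" "m \<in> even_subsets G u"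
  shows "tau G \<sigma> (MV u m) = MV (\<sigma> u) (map_prod \<sigma> \<sigma> ` m)"
proof -
  have "{(\<sigma> u, \<sigma> w) |w. (u, w) \<in> m} = map_prod \<sigma> \<sigma> ` m"
    using assms(2) unfolding even_subsets_def by fastforce
  then show ?thesis using assms by (simp add: tau_def)
qed

lemma tau_in_Aut:
  assumes \<sigma>: "\<sigma> \<in> Aut G" shows "tau G \<sigma> \<in> Aut (Y G)"
proof -
  let ?t = "tau G \<sigma>"
  have inj: "inj \<sigma>" by (rule Aut_inj[OF \<sigma>])
  have injm: "map_prod \<sigma> \<sigma> ` m = map_prod \<sigma> \<sigma> ` n \<longleftrightarrow> m = n" for m n
    using inj by (simp add: inj_image_eq_iff prod.inj_map)
  have mem: "(\<sigma> u, \<sigma> v) \<in> map_prod \<sigma> \<sigma> ` m \<longleftrightarrow> (u, v) \<in> m" for u v m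
    using inj by (auto simp: inj_eq)
  have "?t x \<in> verts (Y G)" if "x \<in> verts (Y G)" for x
    using that \<sigma>
    by (cases x rule: yvert_cv_cases) (auto simp: tau_cv tau_MV Aut_verts Aut_E even_subsets_image)
  then have "?t ` verts (Y G) \<subseteq> verts (Y G)" by blast
  moreover have "x = y" if "x \<in> verts (Y G)" "y \<in> verts (Y G)" "?t x = ?t y" for x y
    using that inj
    by (cases x rule: yvert_cv_cases; cases y rule: yvert_cv_cases)
      (auto simp: tau_cv tau_MV injm inj_eq)
  then have "inj_on ?t (verts (Y G))" by (rule inj_onI)
  ultimately have "bij_betw ?t (verts (Y G)) (verts (Y G))"
    by (simp add: bij_betw_def endo_inj_surj finite_Y)
  then have "?t permutes verts (Y G)" by (rule bij_imp_permutes) (simp add: tau_def)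
  moreover have cM: "adj (?t (cv s u v)) (?t (MV w m))" if "adj (cv s u v) (MV w m)" for s u v w m
  proof -
    have h: "w = u" "E u v" "m \<in> even_subsets G u" "((u, v) \<in> m) = s" using that by auto
    have "u \<in> verts G" using E_verts[OF h(2)] by simp
    then show ?thesis
      using h(2-4) unfolding h(1) by (simp add: tau_cv tau_MV Aut_E[OF \<sigma>] even_subsets_image[OF \<sigma>] mem)
  qed
  have cc: "adj (?t (cv s u v)) (?t (cv t u' v'))" if "adj (cv s u v) (cv t u' v')" for s t u v u' v'
  proof -
    have h: "t = s" "u' = v" "v' = u" "E u v" "E v u" using that by (auto simp: insert_commute)
    show ?thesis unfolding h(1-3) using h(4,5) by (simp add: tau_cv Aut_E[OF \<sigma>])
  qed
  have adj: "adj (?t x) (?t y)" if a: "adj x y" for x y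
  proof (cases x rule: yvert_cv_cases)
    case (1 s u v)
    show ?thesis
    proof (cases y rule: yvert_cv_cases)
      case (1 t u' v')
      show ?thesis using a unfolding \<open>x = cv s u v\<close> 1 by (rule cc)
    next
      case (2 w m)
      show ?thesis using a unfolding \<open>x = cv s u v\<close> 2 by (rule cM)
    qed
  next
    case (2 u m)
    then have "\<exists>s u' v. y = cv s u' v"
      using a by (cases y rule: yvert_cv_cases) simp_all
    then obtain s u' v where y: "y = cv s u' v" by blast
    have "adj (cv s u' v) (MV u m)" using a unfolding 2 y by (rule adj_sym[THEN iffD1])
    then have "adj (?t (cv s u' v)) (?t (MV u m))" by (rule cM)
    then show ?thesis unfolding 2 y by (rule adj_sym[THEN iffD1])
  qed
  have "?t ` e \<in> edges (Y G)" if e_in: "e \<in> edges (Y G)" for e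
  proof -
    obtain x y where e: "e = {x, y}" using e_in by (rule edge_of_Y)
    show ?thesis using adj[of x y] e_in unfolding e by simp
  qed
  ultimately show ?thesis
    using edges_Y_subset finite_edges_Y by (intro Aut_from_edges)
qed

section \<open>Colour-preserving automorphisms\<close>

lemma Aut_X_cv:
  assumes "f \<in> Aut_X G" "E u v" obtains t where "f (cv s u v) = cv t u v"
proof -
  have "same_color G (f (cv s u v)) (cv s u v)" using assms by (simp add: Aut_X_def)
  then show ?thesis using same_color_cv[OF assms(2)] that by blast
qed

lemma Aut_X_MV:
  assumes "f \<in> Aut_X G" "u \<in> verts G" "m \<in> even_subsets G u"
  obtains n where "n \<in> even_subsets G u" "f (MV u m) = MV u n"
proof -
  have "same_color G (f (MV u m)) (MV u m)" using assms by (simp add: Aut_X_def)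
  then show ?thesis using same_color_MV[OF assms(2,3)] that by blast
qed

text \<open>Within its gadget a middle vertex is determined by its neighbours, so the values on the
  \<open>a\<close> and \<open>b\<close> vertices fix everything.\<close>

lemma Aut_X_eqI:
  assumes f: "f \<in> Aut_X G" and f': "f' \<in> Aut_X G"
    and eq: "\<And>s u v. E u v \<Longrightarrow> f (cv s u v) = f' (cv s u v)"
  shows "f = f'"
proof
  interpret f: Y_aut G f using f by unfold_locales (simp add: Aut_X_def)
  interpret f': Y_aut G f' using f' by unfold_locales (simp add: Aut_X_def)
  fix x
  consider "x \<notin> verts (Y G)" | s u v where "x = cv s u v" "E u v"
    | u m where "x = MV u m" "u \<in> verts G" "m \<in> even_subsets G u"
    by (cases x rule: yvert_cv_cases) auto
  then show "f x = f' x"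
  proof cases
    case 1
    then show ?thesis
      using permutes_not_in[OF f.g_permutes] permutes_not_in[OF f'.g_permutes] by simp
  next
    case 2
    then show ?thesis by (simp add: eq)
  next
    case (3 u m)
    obtain n where n: "n \<in> even_subsets G u" "f (MV u m) = MV u n"
      using Aut_X_MV[OF f 3(2,3)] .
    obtain n' where n': "n' \<in> even_subsets G u" "f' (MV u m) = MV u n'"
      using Aut_X_MV[OF f' 3(2,3)] .
    have "(u, w) \<in> n \<longleftrightarrow> (u, w) \<in> n'" if w: "E u w" for w
    proof -
      \<comment> \<open>Both maps send this neighbour of \<open>MV u m\<close> to the same
        \<open>cv t u w\<close>; adjacency then makes \<open>t\<close> the membership of
        \<open>(u, w)\<close> in both \<open>n\<close> and \<open>n'\<close>.\<close>
      let ?c = "cv ((u, w) \<in> m) u w"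
      have a: "adj ?c (MV u m)" using w 3 by simp
      obtain t where t: "f ?c = cv t u w" using Aut_X_cv[OF f w] .
      have "adj (cv t u w) (MV u n)"
        using f.g_adj[of ?c "MV u m"] a unfolding t n(2) by simp
      moreover have "adj (cv t u w) (MV u n')"
        using f'.g_adj[of ?c "MV u m"] a unfolding eq[OF w, symmetric] t n'(2) by simp
      ultimately show ?thesis by simp
    qed
    then have "n = n'" by (rule even_subsets_eqI[OF n(1) n'(1)])
    then show ?thesis using n n' 3 by simp
  qed
qed

end

section \<open>Existence and uniqueness of the decomposition\<close>

context Y_aut
begin

lemma decomposition:
  assumes total: "\<And>v. v \<in> verts G \<Longrightarrow> \<exists>v'. onto_gadget v v'"
    and isolated: "\<And>v. v \<in> verts G \<Longrightarrow> \<exists>w. E v w"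
  obtains f \<sigma> where "f \<in> Aut_X G" "\<sigma> \<in> Aut G" "g = f \<circ> tau G \<sigma>"
proof -
  obtain \<sigma> where \<sigma>: "\<sigma> \<in> Aut G" and onto: "\<And>v. v \<in> verts G \<Longrightarrow> onto_gadget v (\<sigma> v)"
    using onto_gadget_Aut[OF total isolated] by blast
  have tau: "tau G \<sigma> \<in> Aut (Y G)" by (rule tau_in_Aut[OF \<sigma>])
  then have perm: "tau G \<sigma> permutes verts (Y G)" by (simp add: Aut_def)
  define f where "f = g \<circ> inv (tau G \<sigma>)"
  have f: "f \<in> Aut (Y G)" unfolding f_def by (rule Aut_comp[OF g Aut_inv[OF tau]])
  have ft: "f (tau G \<sigma> x) = g x" for x
    using permutes_inverses(2)[OF perm] by (simp add: f_def)
  \<comment> \<open>Since \<open>tau G \<sigma>\<close> is onto the vertices, comparing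
    \<open>g x\<close> with \<open>tau G \<sigma> x\<close> amounts to comparing \<open>f y\<close>
    with \<open>y\<close>.\<close>
  have "same_color G (g x) (tau G \<sigma> x)" if x: "x \<in> verts (Y G)" for x
  proof (cases x rule: yvert_cv_cases)
    case (1 s u v)
    then have uv: "E u v" using x by simp
    then have V: "u \<in> verts G" "v \<in> verts G" using E_verts by auto
    obtain w' c where w': "E (\<sigma> u) w'" "onto_gadget v w'"
        "\<forall>s. g (cv s u v) = cv (s = c) (\<sigma> u) w'"
      using onto_gadget_neighbour[OF onto[OF V(1)] uv] .
    have "w' = \<sigma> v" using onto_gadget_unique[OF w'(2) onto[OF V(2)]] .
    then show ?thesis using 1 uv w'(3) by (simp add: tau_cv same_color_cv Aut_E[OF \<sigma>])
  next
    case (2 u m)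
    then have V: "u \<in> verts G" "m \<in> even_subsets G u" using x by auto
    then have "\<exists>m'\<in>even_subsets G (\<sigma> u). g (MV u m) = MV (\<sigma> u) m'"
      using onto[OF V(1)] by (simp add: onto_gadget_def)
    moreover have "\<sigma> u \<in> verts G" using \<sigma> V by (simp add: Aut_verts)
    ultimately show ?thesis
      using 2 V by (simp add: tau_MV same_color_MV even_subsets_image[OF \<sigma>])
  qed
  then have "same_color G (f y) y" if "y \<in> verts (Y G)" for y
    using that permutes_image[OF perm] ft by (metis imageE)
  then have "f \<in> Aut_X G" using f by (simp add: Aut_X_def)
  moreover have "g = f \<circ> tau G \<sigma>" using ft by (simp add: fun_eq_iff)
  ultimately show ?thesis using that \<sigma> by blast
qed

text \<open>Colour preservation keeps the index pair of a \<open>cv\<close> vertex, so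
  \<open>g\<close> reveals \<open>\<sigma>\<close>. As \<open>\<sigma>\<close> is onto,
  \<open>f\<close> is then known on all \<open>cv\<close> vertices and \<open>Aut_X_eqI\<close>
  applies.\<close>

lemma decomposition_unique:
  assumes isolated: "\<And>v. v \<in> verts G \<Longrightarrow> \<exists>w. E v w"
    and f: "f \<in> Aut_X G" "\<sigma> \<in> Aut G"
      "\<And>s u v. E u v \<Longrightarrow> g (cv s u v) = f (cv s (\<sigma> u) (\<sigma> v))"
    and f': "f' \<in> Aut_X G" "\<sigma>' \<in> Aut G"
      "\<And>s u v. E u v \<Longrightarrow> g (cv s u v) = f' (cv s (\<sigma>' u) (\<sigma>' v))"
  shows "\<sigma> = \<sigma>' \<and> f = f'"
proof
  show \<sigma>: "\<sigma> = \<sigma>'"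
  proof
    fix u
    show "\<sigma> u = \<sigma>' u"
    proof (cases "u \<in> verts G")
      case True
      then obtain v where uv: "E u v" using isolated by blast
      obtain t where "f (cv True (\<sigma> u) (\<sigma> v)) = cv t (\<sigma> u) (\<sigma> v)"
        using Aut_X_cv[OF f(1)] uv Aut_E[OF f(2)] by metis
      moreover obtain t' where "f' (cv True (\<sigma>' u) (\<sigma>' v)) = cv t' (\<sigma>' u) (\<sigma>' v)"
        using Aut_X_cv[OF f'(1)] uv Aut_E[OF f'(2)] by metis
      ultimately show ?thesis using f(3)[OF uv, of True] f'(3)[OF uv, of True] by simp
    next
      case False
      then show ?thesis using f(2) f'(2) unfolding Aut_def mem_Collect_eq by (metis permutes_not_in)
    qed
  qed
  show "f = f'"
  proof (rule Aut_X_eqI[OF f(1) f'(1)])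
    fix s u v assume uv: "E u v"
    have "\<sigma> permutes verts G" using f(2) by (simp add: Aut_def)
    then obtain a b where ab: "u = \<sigma> a" "v = \<sigma> b" by (metis permutes_surj surjD)
    then have "E a b" using uv Aut_E[OF f(2)] by simp
    then show "f (cv s u v) = f' (cv s u v)"
      using f(3)[of a b s] f'(3)[of a b s] \<sigma> ab by simp
  qed
qed

end

section \<open>Consequences of the hypotheses on \<open>G\<close>, and the final assembly\<close>

lemma max_degree_big:
  assumes "simple_graph G" "verts G \<noteq> {}" "max_degree G \<ge> 3"
  obtains u where "u \<in> verts G" "sgraph.big G u"
proof -
  interpret sgraph G by unfold_locales (rule assms)
  have "max_degree G \<in> degree G ` verts G"
    unfolding max_degree_def using finite_verts assms(2) by (intro Max_in) auto
  then obtain u where u: "u \<in> verts G" "card {v. E u v} \<ge> 3"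
    using assms(3) by (auto simp: degree_def)
  obtain S where S: "S \<subseteq> {v. E u v}" "card S = 3"
    by (rule obtain_subset_with_card_n[OF u(2)])
  obtain i j k where "S = {i, j, k}" "i \<noteq> j" "j \<noteq> k" "i \<noteq> k"
    using S(2) unfolding card_3_iff by blast
  then have "big u"
    using S(1) unfolding big_def by (intro exI[of _ i] exI[of _ j] exI[of _ k]) simp
  with u show ?thesis using that by blast
qed

text \<open>The first step of a walk from \<open>u\<close> to another vertex is an edge at
  \<open>u\<close>.\<close>

lemma connected_no_isolated:
  assumes "connected_graph G" "card (verts G) \<ge> 2" "u \<in> verts G"
  shows "\<exists>v. {u, v} \<in> edges G"
proof -
  have "\<not> verts G \<subseteq> {u}"
    using assms(2) card_mono[of "{u}" "verts G"] by auto
  then obtain v where v: "v \<in> verts G" "v \<noteq> u" by blast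
  then have "(u, v) \<in> {(x, y). {x, y} \<in> edges G}\<^sup>*"
    using assms by (simp add: connected_graph_def)
  then show ?thesis using v by (auto elim: converse_rtranclE)
qed

theorem theorem7p4:
  fixes G :: "'a ugraph"
  assumes "simple_graph G"
    and "connected_graph G"
    and "card (verts G) \<ge> 2"
    and "max_degree G \<ge> 3"
  shows "(\<forall>g\<in>Aut (Y G).
      \<exists>!(\<sigma>, f). \<sigma> \<in> Aut G \<and> f \<in> Aut_X G \<and>
        (\<forall>u v. {u, v} \<in> edges G \<longrightarrow>
           g (AV u v) = f (AV (\<sigma> u) (\<sigma> v)) \<and>
           g (BV u v) = f (BV (\<sigma> u) (\<sigma> v))))
    \<and> Aut (Y G) = {f \<circ> tau G \<sigma> | f \<sigma>. f \<in> Aut_X G \<and> \<sigma> \<in> Aut G}"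
proof (intro conjI ballI)
  interpret sgraph G by unfold_locales (rule assms)
  have "verts G \<noteq> {}" using assms(2) by (simp add: connected_graph_def)
  then obtain u0 where u0: "u0 \<in> verts G" "big u0"
    using assms(4) by (rule max_degree_big[OF assms(1)])
  have isolated: "\<exists>w. E v w" if "v \<in> verts G" for v
    using connected_no_isolated[OF assms(2,3) that] .
  have dec: "\<exists>f \<sigma>. g = f \<circ> tau G \<sigma> \<and> f \<in> Aut_X G \<and> \<sigma> \<in> Aut G" if "g \<in> Aut (Y G)" for g
  proof -
    interpret Y_aut G g by unfold_locales (rule that)
    obtain f \<sigma> where "f \<in> Aut_X G" "\<sigma> \<in> Aut G" "g = f \<circ> tau G \<sigma>"
      by (rule decomposition[OF onto_gadget_total[OF assms(2) u0(2,1)] isolated])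
    then show ?thesis by (intro exI conjI)
  qed
  have "f \<circ> tau G \<sigma> \<in> Aut (Y G)" if "f \<in> Aut_X G" "\<sigma> \<in> Aut G" for f \<sigma>
    using that tau_in_Aut Aut_comp by (auto simp: Aut_X_def)
  then show "Aut (Y G) = {f \<circ> tau G \<sigma> | f \<sigma>. f \<in> Aut_X G \<and> \<sigma> \<in> Aut G}"
    by (intro equalityI subsetI CollectI) (erule dec, auto)
  fix g assume g: "g \<in> Aut (Y G)"
  interpret Y_aut G g by unfold_locales (rule g)
  let ?P = "\<lambda>\<sigma> f. \<sigma> \<in> Aut G \<and> f \<in> Aut_X G \<and>
        (\<forall>u v. {u, v} \<in> edges G \<longrightarrow>
           g (AV u v) = f (AV (\<sigma> u) (\<sigma> v)) \<and>
           g (BV u v) = f (BV (\<sigma> u) (\<sigma> v)))"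
  have P: "g (cv s u v) = f (cv s (\<sigma> u) (\<sigma> v))" if "?P \<sigma> f" "E u v" for \<sigma> f s u v
    using that by (cases s) (simp_all add: cv_def)
  obtain f \<sigma> where f: "f \<in> Aut_X G" "\<sigma> \<in> Aut G" "g = f \<circ> tau G \<sigma>"
    using dec[OF g] by (elim exE conjE)
  have ex: "?P \<sigma> f" unfolding AV_eq_cv BV_eq_cv using f by (simp add: tau_cv)
  have uniq: "\<sigma>' = \<sigma> \<and> f' = f" if "?P \<sigma>' f'" for \<sigma>' f'
    by (rule decomposition_unique[OF isolated _ _ P[OF that] f(1,2) P[OF ex]]) (use that in simp_all)
  show "\<exists>!(\<sigma>, f). ?P \<sigma> f"
  proof (rule ex1I[of _ "(\<sigma>, f)"], unfold prod.case)
    fix p assume "case p of (\<sigma>, f) \<Rightarrow> ?P \<sigma> f"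
    then show "p = (\<sigma>, f)" using uniq[of "fst p" "snd p"] by (simp add: case_prod_beta prod_eq_iff)
  qed (rule ex)
qed

end
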